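(* Let $A$ be a symmetric, irreducible, nonnegative matrix of size $n\times n$ and let $\mathcal{P}=\{P_1,\ldots,P_k\}$ be a partition of $[n]$ such that $A[P_i,P_j]$ is regular for all $1\leq i<j\leq k$. Then $$\mu_1(A)=\mu_1(A|\mathcal{P}\times\mathcal{P})$$ if and only if $A[P_i,P_i]$ is regular for all $1\leq i\leq k$, i.e., $\mathcal{P}\times\mathcal{P}$ is equitable for $A$.
   Context: $[n]=\{1,\ldots,n\}$; partitions consist of nonempty sets. For a Hermitian matrix $M$, $\mu_1(M)$ denotes its largest eigenvalue. For $A=\{a_{ij}\}$ and $I,J\subset[n]$, $A[I,J]$ is the submatrix of all $a_{ij}$ with $i\in I$, $j\in J$. A matrix is called regular if all its row sums are equal and all its column sums are equal. For a partition $\mathcal{P}=\{P_1,\ldots,P_k\}$ of $[n]$, $\mathcal{P}\times\mathcal{P}=\{P_i\times P_j: i,j\in[k]\}$ is called equitable for $A$ if $A[P_p,P_q]$ is regular for all $p,q\in[k]$. $A|\mathcal{P}\times\mathcal{P}$ denotes the $k\times k$ (quotient) matrix $\{b_{pq}\}$ with $$b_{pq}=\frac{1}{\sqrt{|P_p||P_q|}}\sum_{i\in P_p,\,j\in P_q}a_{ij}.$$ *)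

theory Defs
  imports
    "Jordan_Normal_Form.Char_Poly"
    "Jordan_Normal_Form.DL_Submatrix"
    "HOL-Combinatorics.Permutations"
    "HOL-Library.Disjoint_Sets"
begin

text \<open>Rows and columns are indexed from \<open>0\<close>, so \<open>{..<n}\<close> plays the role of \<open>[n]\<close>, and a
  partition of it into \<open>k\<close> cells is an enumeration \<open>P 0, \<dots>, P (k - 1)\<close> of its cells.\<close>

definition indexed_partition :: "nat \<Rightarrow> nat \<Rightarrow> (nat \<Rightarrow> nat set) \<Rightarrow> bool" where
  "indexed_partition n k P \<longleftrightarrow> inj_on P {..<k} \<and> partition_on {..<n} (P ` {..<k})"

text \<open>The spectrum of a Hermitian matrix is real; for such matrices of positive size the set below
  is finite and nonempty. Over the reals \<^const>\<open>of_real\<close> is the identity.\<close>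

definition mu1 :: "'a::real_field mat \<Rightarrow> real" where
  "mu1 M = Max {x. eigenvalue M (of_real x)}"

text \<open>A matrix is reducible if a simultaneous permutation of its rows and columns makes it block
  upper triangular, with nonempty square diagonal blocks of sizes \<open>m\<close> and \<open>n - m\<close>.\<close>

definition reducible_mat :: "'a::zero mat \<Rightarrow> bool" where
  "reducible_mat A \<longleftrightarrow> (let n = dim_row A in
     \<exists>p m. p permutes {..<n} \<and> 0 < m \<and> m < n \<and>
       (\<forall>i\<in>{m..<n}. \<forall>j\<in>{..<m}. A $$ (p i, p j) = 0))"

definition irreducible_mat :: "'a::zero mat \<Rightarrow> bool" where
  "irreducible_mat A \<longleftrightarrow> square_mat A \<and> \<not> reducible_mat A"

definition regular_mat :: "'a::comm_monoid_add mat \<Rightarrow> bool" where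
  "regular_mat B \<longleftrightarrow>
     (\<forall>i<dim_row B. \<forall>i'<dim_row B.
        (\<Sum>j<dim_col B. B $$ (i, j)) = (\<Sum>j<dim_col B. B $$ (i', j))) \<and>
     (\<forall>j<dim_col B. \<forall>j'<dim_col B.
        (\<Sum>i<dim_row B. B $$ (i, j)) = (\<Sum>i<dim_row B. B $$ (i, j')))"

definition equitable :: "'a::comm_monoid_add mat \<Rightarrow> nat \<Rightarrow> (nat \<Rightarrow> nat set) \<Rightarrow> bool" where
  "equitable A k P \<longleftrightarrow> (\<forall>p<k. \<forall>q<k. regular_mat (submatrix A (P p) (P q)))"

definition quotient_mat :: "'a::real_field mat \<Rightarrow> nat \<Rightarrow> (nat \<Rightarrow> nat set) \<Rightarrow> 'a mat" where
  "quotient_mat A k P = mat k k (\<lambda>(p, q).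
     of_real (1 / sqrt (real (card (P p)) * real (card (P q)))) *
     (\<Sum>i\<in>P p. \<Sum>j\<in>P q. A $$ (i, j)))"

end

theory Submission
  imports
    Defs
    "HOL-Analysis.Function_Topology"
    "Jordan_Normal_Form.Spectral_Radius"
begin

text \<open>
  Let \<open>S\<close> be the \<open>n \<times> k\<close> matrix whose columns are the normalised indicator vectors of the cells.
  Then \<open>S\<^sup>T S = 1\<close> and the quotient matrix is \<open>Q = S\<^sup>T A S\<close>. Hence the Rayleigh quotient of \<open>Q\<close>
  at \<open>y\<close> is the Rayleigh quotient of \<open>A\<close> at the lifted vector \<open>S y\<close>, and \<open>\<mu>\<^sub>1(Q) \<le> \<mu>\<^sub>1(A)\<close>
  for every partition (\<open>mu1_quotient_mat_le\<close>).

  If the partition is equitable, then \<open>S\<^sup>T A = Q S\<^sup>T\<close>, so \<open>S\<^sup>T\<close> sends an eigenvector of \<open>A\<close> to a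
  vector satisfying the eigenvalue equation of \<open>Q\<close>. Applied to a nonnegative eigenvector for
  \<open>\<mu>\<^sub>1(A)\<close>, whose image is not zero, this gives \<open>\<mu>\<^sub>1(A) \<le> \<mu>\<^sub>1(Q)\<close>
  (\<open>mu1_le_mu1_quotient_mat_if_equitable\<close>).

  Conversely, suppose that the two values agree and lift a nonnegative maximiser \<open>y\<close> of the Rayleigh
  quotient of \<open>Q\<close>. The lift maximises the Rayleigh quotient of \<open>A\<close>, so it is an eigenvector of \<open>A\<close>,
  and irreducibility makes all of its entries positive (\<open>nonneg_eigenvector_positive\<close>). It takes a
  constant value \<open>z\<^sub>p > 0\<close> on the cell \<open>P p\<close>. Solving row \<open>i \<in> P p\<close> of the eigenvalue equation for
  \<open>z\<^sub>p\<close> times the row sum of the diagonal block leaves an expression in the row sums of the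
  off-diagonal blocks, which does not depend on the choice of \<open>i\<close>
  (\<open>diagonal_blocks_regular_if_mu1_eq\<close>).

  The variational description of \<open>\<mu>\<^sub>1\<close> (\<open>mu1_eq_max_quad_form\<close>) comes from compactness of the unit
  sphere and a first-variation argument.
\<close>

section \<open>Quadratic forms of real symmetric matrices\<close>

definition apply_mat :: "real mat \<Rightarrow> (nat \<Rightarrow> real) \<Rightarrow> nat \<Rightarrow> real" where
  "apply_mat M x i = (\<Sum>j<dim_row M. M $$ (i, j) * x j)"

definition quad_form :: "real mat \<Rightarrow> (nat \<Rightarrow> real) \<Rightarrow> real" where
  "quad_form M x = (\<Sum>i<dim_row M. x i * apply_mat M x i)"

lemma quad_form_add_scaled:
  assumes sym: "\<forall>i<dim_row M. \<forall>j<dim_row M. M $$ (i, j) = M $$ (j, i)"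
  shows "quad_form M (\<lambda>i. x i + t * h i)
       = quad_form M x + 2 * t * (\<Sum>i<dim_row M. h i * apply_mat M x i) + t\<^sup>2 * quad_form M h"
proof -
  let ?I = "{..<dim_row M}"
  have "(\<Sum>i\<in>?I. x i * apply_mat M h i) = (\<Sum>i\<in>?I. \<Sum>j\<in>?I. x i * (M $$ (i, j) * h j))"
    by (simp add: apply_mat_def sum_distrib_left)
  also have "\<dots> = (\<Sum>j\<in>?I. \<Sum>i\<in>?I. x i * (M $$ (i, j) * h j))"
    by (rule sum.swap)
  also have "\<dots> = (\<Sum>j\<in>?I. h j * apply_mat M x j)"
    unfolding apply_mat_def sum_distrib_left
    by (intro sum.cong refl) (use sym in auto)
  finally have swap: "(\<Sum>i\<in>?I. x i * apply_mat M h i) = (\<Sum>i\<in>?I. h i * apply_mat M x i)" .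
  have app: "apply_mat M (\<lambda>i. x i + t * h i) i = apply_mat M x i + t * apply_mat M h i" for i
    by (simp add: apply_mat_def algebra_simps sum.distrib sum_distrib_left)
  have "quad_form M (\<lambda>i. x i + t * h i)
      = quad_form M x + t * (\<Sum>i\<in>?I. x i * apply_mat M h i)
        + t * (\<Sum>i\<in>?I. h i * apply_mat M x i) + t\<^sup>2 * quad_form M h"
    unfolding quad_form_def app
    by (simp add: algebra_simps sum.distrib sum_distrib_left power2_eq_square)
  then show ?thesis using swap by simp
qed

text \<open>First variation: moving from a maximiser \<open>x\<close> in the direction of the residual
  \<open>h = l x - M x\<close> changes the nonnegative gap \<open>l |x|\<^sup>2 - x\<^sup>T M x\<close> by
  \<open>2 t |h|\<^sup>2 + O(t\<^sup>2)\<close>, so the residual vanishes.\<close>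

lemma eigenvector_of_maximal_quad_form:
  assumes sym: "\<forall>i<dim_row M. \<forall>j<dim_row M. M $$ (i, j) = M $$ (j, i)"
    and bound: "\<And>y. quad_form M y \<le> l * (\<Sum>i<dim_row M. (y i)\<^sup>2)"
    and eq: "quad_form M x = l * (\<Sum>i<dim_row M. (x i)\<^sup>2)"
    and i: "i < dim_row M"
  shows "apply_mat M x i = l * x i"
proof -
  let ?I = "{..<dim_row M}"
  define h where "h i = l * x i - apply_mat M x i" for i
  define b where "b = (\<Sum>i\<in>?I. (h i)\<^sup>2)"
  define c where "c = l * b - quad_form M h"
  have bh: "b = l * (\<Sum>i\<in>?I. h i * x i) - (\<Sum>i\<in>?I. h i * apply_mat M x i)"
    unfolding b_def sum_distrib_left sum_subtractf[symmetric]
    by (intro sum.cong refl) (simp add: h_def power2_eq_square algebra_simps)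
  have gap: "0 \<le> 2 * t * b + t\<^sup>2 * c" for t
  proof -
    have "(\<Sum>i\<in>?I. (x i + t * h i)\<^sup>2)
        = (\<Sum>i\<in>?I. (x i)\<^sup>2) + 2 * t * (\<Sum>i\<in>?I. h i * x i) + t\<^sup>2 * b"
      unfolding b_def
      by (simp add: power2_eq_square algebra_simps sum.distrib sum_distrib_left)
    with bound[of "\<lambda>i. x i + t * h i"] eq
    have "quad_form M x + 2 * t * (\<Sum>i\<in>?I. h i * apply_mat M x i) + t\<^sup>2 * quad_form M h
        \<le> l * ((\<Sum>i\<in>?I. (x i)\<^sup>2) + 2 * t * (\<Sum>i\<in>?I. h i * x i) + t\<^sup>2 * b)"
      by (simp only: quad_form_add_scaled[OF sym])
    then show ?thesis unfolding eq bh c_def by (simp add: algebra_simps)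
  qed
  have b0: "b \<ge> 0" unfolding b_def by (simp add: sum_nonneg)
  have "b = 0"
  proof (rule ccontr)
    assume "b \<noteq> 0"
    with b0 have bpos: "b > 0" by simp
    \<comment> \<open>The step \<open>- b / d\<close> is small enough for the linear term to dominate.\<close>
    define d where "d = \<bar>c\<bar> + 1"
    have d: "d > 0" "c < d" unfolding d_def by auto
    have "2 * (- b / d) * b + (- b / d)\<^sup>2 * c = b\<^sup>2 / d * (c / d - 2)"
      using d by (simp add: field_simps power2_eq_square)
    also have "\<dots> < 0"
      using bpos d by (intro mult_pos_neg) (auto simp: field_simps)
    finally show False using gap[of "- b / d"] by simp
  qed
  then have "\<forall>i\<in>?I. (h i)\<^sup>2 = 0"
    unfolding b_def by (subst (asm) sum_nonneg_eq_0_iff) auto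
  with i show ?thesis unfolding h_def by auto
qed

text \<open>The vectors are functions on all of \<open>nat\<close>, and the form and the norm ignore the coordinates at
  or beyond the size of the matrix. Confining every coordinate to \<open>[-1, 1]\<close> turns the unit sphere
  into a closed subset of a product of compact intervals, which is compact by Tychonoff's theorem;
  homogeneity extends the bound from there to all vectors.\<close>

lemma quad_form_attains_max_on_sphere:
  assumes n: "dim_row M \<ge> 1"
  obtains x where "(\<Sum>i<dim_row M. (x i)\<^sup>2) = 1"
    and "\<And>y. quad_form M y \<le> quad_form M x * (\<Sum>i<dim_row M. (y i)\<^sup>2)"
proof -
  let ?I = "{..<dim_row M}"
  define S :: "(nat \<Rightarrow> real) set" where
    "S = (\<Pi>\<^sub>E i\<in>UNIV. {-1..1}) \<inter> {x. (\<Sum>i\<in>?I. (x i)\<^sup>2) = 1}"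
  have cc: "continuous_on T (\<lambda>x::nat \<Rightarrow> real. x i)" for T i
    by (rule continuous_on_subset[OF continuous_on_product_coordinates]) simp
  have "compactin (product_topology (\<lambda>i::nat. euclidean) UNIV) (\<Pi>\<^sub>E i\<in>UNIV. {-1..1::real})"
    unfolding compactin_PiE compactin_euclidean_iff using compact_Icc by blast
  then have "compact (\<Pi>\<^sub>E i\<in>(UNIV::nat set). {-1..1::real})"
    by (simp add: euclidean_product_topology compactin_euclidean_iff)
  moreover have "closed {x::nat \<Rightarrow> real. (\<Sum>i\<in>?I. (x i)\<^sup>2) = 1}"
    by (intro closed_Collect_eq continuous_intros cc)
  ultimately have compS: "compact S"
    unfolding S_def by (rule compact_Int_closed)
  have "(\<lambda>i. if i = 0 then 1 else 0) \<in> S"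
  proof -
    have "(\<Sum>i\<in>?I. (if i = 0 then 1 else 0 :: real)\<^sup>2) = (\<Sum>i\<in>?I. if i = 0 then 1 else 0)"
      by (intro sum.cong refl) auto
    also have "\<dots> = 1" using n by simp
    finally show ?thesis unfolding S_def by auto
  qed
  then have neS: "S \<noteq> {}" by blast
  have "continuous_on S (quad_form M)"
    unfolding quad_form_def apply_mat_def by (intro continuous_intros cc)
  from continuous_attains_sup[OF compS neS this]
  obtain x where x: "x \<in> S" and max: "\<And>y. y \<in> S \<Longrightarrow> quad_form M y \<le> quad_form M x" by blast
  have "quad_form M y \<le> quad_form M x * (\<Sum>i\<in>?I. (y i)\<^sup>2)" for y
  proof (cases "(\<Sum>i\<in>?I. (y i)\<^sup>2) = 0")
    case True
    then have "\<forall>i\<in>?I. y i = 0" by (subst (asm) sum_nonneg_eq_0_iff) auto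
    then have "quad_form M y = 0" unfolding quad_form_def by simp
    with True show ?thesis by simp
  next
    case False
    define r where "r = sqrt (\<Sum>i\<in>?I. (y i)\<^sup>2)"
    have r2: "r\<^sup>2 = (\<Sum>i\<in>?I. (y i)\<^sup>2)" unfolding r_def by (simp add: sum_nonneg)
    have r: "r > 0" using False unfolding r_def by (simp add: sum_nonneg less_le)
    define z where "z i = (if i < dim_row M then y i / r else 0)" for i
    have z1: "(\<Sum>i\<in>?I. (z i)\<^sup>2) = 1"
    proof -
      have "(\<Sum>i\<in>?I. (z i)\<^sup>2) = (\<Sum>i\<in>?I. (y i)\<^sup>2) / r\<^sup>2"
        unfolding z_def by (simp add: power_divide sum_divide_distrib)
      then show ?thesis using r unfolding r2[symmetric] by simp
    qed
    have "\<bar>z i\<bar> \<le> 1" for i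
    proof (cases "i < dim_row M")
      case True
      then have "(z i)\<^sup>2 \<le> 1" using z1 member_le_sum[of i ?I "\<lambda>i. (z i)\<^sup>2"] by auto
      then show ?thesis by (simp add: abs_square_le_1)
    qed (simp add: z_def)
    then have "z \<in> S" using z1 unfolding S_def by (auto simp: abs_le_iff minus_le_iff)
    from max[OF this] have "quad_form M z \<le> quad_form M x" .
    moreover have "quad_form M z = quad_form M y / r\<^sup>2"
      unfolding quad_form_def apply_mat_def z_def
      by (simp add: sum_divide_distrib power2_eq_square sum_distrib_left)
    ultimately show ?thesis using r unfolding r2[symmetric] by (simp add: field_simps)
  qed
  moreover have "(\<Sum>i\<in>?I. (x i)\<^sup>2) = 1" using x unfolding S_def by simp
  ultimately show ?thesis using that by blast
qed

section \<open>The largest eigenvalue\<close>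

lemma eigenvalue_iff_apply_mat:
  assumes M: "M \<in> carrier_mat n n"
  shows "eigenvalue M l \<longleftrightarrow> (\<exists>x. (\<exists>i<n. x i \<noteq> 0) \<and> (\<forall>i<n. apply_mat M x i = l * x i))"
proof -
  have mv: "(M *\<^sub>v v) $ i = apply_mat M (\<lambda>j. v $ j) i" if "i < n" "v \<in> carrier_vec n" for v i
    using that M by (auto simp: apply_mat_def scalar_prod_def lessThan_atLeast0)
  have ac: "apply_mat M x i = apply_mat M y i" if "\<And>j. j < n \<Longrightarrow> x j = y j" for x y i
    unfolding apply_mat_def using that M by (intro sum.cong) auto
  show ?thesis
  proof
    assume "eigenvalue M l"
    then obtain v where v: "v \<in> carrier_vec n" "v \<noteq> 0\<^sub>v n" "M *\<^sub>v v = l \<cdot>\<^sub>v v"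
      unfolding eigenvalue_def eigenvector_def using M by auto
    have "\<exists>i<n. v $ i \<noteq> 0"
    proof (rule ccontr)
      assume "\<not> ?thesis"
      then have "v = 0\<^sub>v n" using v(1) by (intro eq_vecI) auto
      with v(2) show False by simp
    qed
    moreover have "apply_mat M (\<lambda>j. v $ j) i = l * v $ i" if "i < n" for i
      using mv[OF that v(1)] v(1,3) that by simp
    ultimately show "\<exists>x. (\<exists>i<n. x i \<noteq> 0) \<and> (\<forall>i<n. apply_mat M x i = l * x i)" by blast
  next
    assume "\<exists>x. (\<exists>i<n. x i \<noteq> 0) \<and> (\<forall>i<n. apply_mat M x i = l * x i)"
    then obtain x where x: "\<exists>i<n. x i \<noteq> 0" "\<forall>i<n. apply_mat M x i = l * x i" by blast
    define v where "v = vec n x"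
    have vc: "v \<in> carrier_vec n" unfolding v_def by simp
    have "v \<noteq> 0\<^sub>v n"
    proof
      assume "v = 0\<^sub>v n"
      then have "v $ i = 0" if "i < n" for i using that by simp
      then show False using x(1) unfolding v_def by auto
    qed
    moreover have "M *\<^sub>v v = l \<cdot>\<^sub>v v"
    proof (rule eq_vecI)
      fix i assume "i < dim_vec (l \<cdot>\<^sub>v v)"
      then have i: "i < n" unfolding v_def by simp
      have "apply_mat M (\<lambda>j. v $ j) i = apply_mat M x i" by (rule ac) (simp add: v_def)
      with mv[OF i vc] x(2) i show "(M *\<^sub>v v) $ i = (l \<cdot>\<^sub>v v) $ i" unfolding v_def by simp
    qed (use M in \<open>simp add: v_def\<close>)
    ultimately show "eigenvalue M l"
      unfolding eigenvalue_def eigenvector_def using vc M by auto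
  qed
qed

lemma eigenvalue_le_mu1:
  fixes M :: "real mat"
  assumes "M \<in> carrier_mat n n" "eigenvalue M l"
  shows "l \<le> mu1 M"
  using card_finite_spectrum(1)[OF assms(1)] assms(2)
  unfolding mu1_def spectrum_def by (simp add: Max_ge)

text \<open>The maximum of the form on the unit sphere is an eigenvalue by the first variation, and no
  eigenvalue exceeds it because an eigenvalue is the value of the form at a unit eigenvector.\<close>

theorem mu1_eq_max_quad_form:
  assumes M: "M \<in> carrier_mat n n" and n: "n \<ge> 1"
    and sym: "\<forall>i<n. \<forall>j<n. M $$ (i, j) = M $$ (j, i)"
  shows quad_form_le_mu1: "quad_form M y \<le> mu1 M * (\<Sum>i<n. (y i)\<^sup>2)"
    and mu1_attained: "\<exists>x. (\<Sum>i<n. (x i)\<^sup>2) = 1 \<and> quad_form M x = mu1 M"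
proof -
  have dim: "dim_row M = n" using M by simp
  obtain x where x1: "(\<Sum>i<n. (x i)\<^sup>2) = 1"
    and max: "\<And>y. quad_form M y \<le> quad_form M x * (\<Sum>i<n. (y i)\<^sup>2)"
    using quad_form_attains_max_on_sphere[of M] n unfolding dim by blast
  have x0: "\<exists>i<n. x i \<noteq> 0"
  proof (rule ccontr)
    assume "\<not> ?thesis"
    then have "(\<Sum>i<n. (x i)\<^sup>2) = 0" by simp
    with x1 show False by simp
  qed
  have "apply_mat M x i = quad_form M x * x i" if "i < n" for i
    by (rule eigenvector_of_maximal_quad_form) (use sym max x1 that in \<open>auto simp: dim\<close>)
  with x0 have "eigenvalue M (quad_form M x)" unfolding eigenvalue_iff_apply_mat[OF M] by blast
  moreover have "l \<le> quad_form M x" if "eigenvalue M l" for l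
  proof -
    from that obtain z where z0: "\<exists>i<n. z i \<noteq> 0" and z: "\<forall>i<n. apply_mat M z i = l * z i"
      unfolding eigenvalue_iff_apply_mat[OF M] by blast
    have "quad_form M z = l * (\<Sum>i<n. (z i)\<^sup>2)"
      unfolding quad_form_def dim sum_distrib_left
      by (intro sum.cong refl) (use z in \<open>auto simp: power2_eq_square\<close>)
    with max[of z] have le: "l * (\<Sum>i<n. (z i)\<^sup>2) \<le> quad_form M x * (\<Sum>i<n. (z i)\<^sup>2)" by simp
    have "(\<Sum>i<n. (z i)\<^sup>2) > 0"
      using z0 by (auto intro: sum_pos2)
    with le show ?thesis by simp
  qed
  ultimately have "mu1 M = quad_form M x"
    unfolding mu1_def using card_finite_spectrum(1)[OF M, unfolded spectrum_def]
    by (intro Max_eqI) auto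
  then show "quad_form M y \<le> mu1 M * (\<Sum>i<n. (y i)\<^sup>2)"
    and "\<exists>x. (\<Sum>i<n. (x i)\<^sup>2) = 1 \<and> quad_form M x = mu1 M"
    using max x1 by auto
qed

section \<open>Perron vectors of nonnegative symmetric matrices\<close>

text \<open>Replacing a maximiser of the quadratic form by its entrywise absolute value keeps its norm
  and does not decrease the form.\<close>

lemma nonneg_maximiser:
  assumes M: "M \<in> carrier_mat n n" and n: "n \<ge> 1"
    and sym: "\<forall>i<n. \<forall>j<n. M $$ (i, j) = M $$ (j, i)"
    and nonneg: "\<forall>i<n. \<forall>j<n. M $$ (i, j) \<ge> 0"
  obtains x where "\<And>i. x i \<ge> 0" and "(\<Sum>i<n. (x i)\<^sup>2) = 1" and "quad_form M x = mu1 M"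
proof -
  obtain y where y: "(\<Sum>i<n. (y i)\<^sup>2) = 1" "quad_form M y = mu1 M"
    using mu1_attained[OF M n sym] by blast
  have "x i * (M $$ (i, j) * x j) \<le> \<bar>x i\<bar> * (M $$ (i, j) * \<bar>x j\<bar>)"
    if "i < n" "j < n" for i j and x :: "nat \<Rightarrow> real"
    using that nonneg abs_ge_self[of "x i * (M $$ (i, j) * x j)"] by (simp add: abs_mult)
  then have "quad_form M y \<le> quad_form M (\<lambda>i. \<bar>y i\<bar>)"
    using M unfolding quad_form_def apply_mat_def sum_distrib_left
    by (intro sum_mono) auto
  moreover have "quad_form M (\<lambda>i. \<bar>y i\<bar>) \<le> mu1 M"
    using quad_form_le_mu1[OF M n sym, of "\<lambda>i. \<bar>y i\<bar>"] y(1) by simp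
  ultimately show ?thesis using that[of "\<lambda>i. \<bar>y i\<bar>"] y by simp
qed

lemma maximiser_is_eigenvector:
  assumes M: "M \<in> carrier_mat n n" and n: "n \<ge> 1"
    and sym: "\<forall>i<n. \<forall>j<n. M $$ (i, j) = M $$ (j, i)"
    and eq: "quad_form M x = mu1 M * (\<Sum>i<n. (x i)\<^sup>2)" and i: "i < n"
  shows "apply_mat M x i = mu1 M * x i"
proof -
  have dim: "dim_row M = n" using M by simp
  show ?thesis
    by (rule eigenvector_of_maximal_quad_form)
      (use quad_form_le_mu1[OF M n sym] sym eq i in \<open>auto simp: dim\<close>)
qed

text \<open>A permutation that lists the complement of \<open>Z\<close> before \<open>Z\<close> moves the vanishing block to the
  lower left corner.\<close>

lemma reducible_mat_if_zero_block:
  assumes A: "A \<in> carrier_mat n n" and Z: "Z \<subseteq> {..<n}" "Z \<noteq> {}" "Z \<noteq> {..<n}"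
    and zero: "\<And>i j. i \<in> Z \<Longrightarrow> j \<in> {..<n} - Z \<Longrightarrow> A $$ (i, j) = 0"
  shows "reducible_mat A"
proof -
  define C where "C = {..<n} - Z"
  define m where "m = card C"
  have fin: "finite Z" "finite C" using Z(1) finite_subset unfolding C_def by auto
  have Cne: "C \<noteq> {}" using Z unfolding C_def by auto
  have "n = card (C \<union> Z)" using Z(1) unfolding C_def by (simp add: Un_absorb2)
  then have card: "n = m + card Z"
    unfolding m_def using card_Un_disjoint[OF fin(2,1)] unfolding C_def by auto
  have m: "0 < m" "m < n" using card fin Cne Z(2) unfolding m_def by (auto simp: card_gt_0_iff)
  obtain f where f: "bij_betw f {..<m} C"
    using finite_same_card_bij[of "{..<m}" C] fin unfolding m_def by auto
  obtain g where g: "bij_betw g {m..<n} Z"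
    using finite_same_card_bij[of "{m..<n}" Z] fin card by auto
  define p where "p i = (if i < m then f i else if i < n then g i else i)" for i
  have pC: "bij_betw p {..<m} C"
    using f by (rule bij_betw_cong[THEN iffD1, rotated]) (simp add: p_def)
  have pZ: "bij_betw p {m..<n} Z"
    using g by (rule bij_betw_cong[THEN iffD1, rotated]) (simp add: p_def)
  have "bij_betw p ({..<m} \<union> {m..<n}) (C \<union> Z)"
    by (rule bij_betw_combine[OF pC pZ]) (auto simp: C_def)
  moreover have "{..<m} \<union> {m..<n} = {..<n}" "C \<union> Z = {..<n}"
    using m Z(1) unfolding C_def by auto
  ultimately have "p permutes {..<n}"
    by (intro bij_imp_permutes) (use m in \<open>auto simp: p_def\<close>)
  moreover have "A $$ (p i, p j) = 0" if "i \<in> {m..<n}" "j \<in> {..<m}" for i j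
    using zero that bij_betwE[OF pZ] bij_betwE[OF pC] unfolding C_def by blast
  ultimately show ?thesis
    unfolding reducible_mat_def Let_def carrier_matD(1)[OF A] using m
    by (intro exI[of _ p] exI[of _ m]) simp
qed

text \<open>A vanishing entry of an eigenvector \<open>x \<ge> 0\<close> forces \<open>a\<^sub>i\<^sub>j = 0\<close> for every \<open>i\<close> in the zero
  set of \<open>x\<close> and every \<open>j\<close> outside it, which is exactly a reducing block.\<close>

lemma nonneg_eigenvector_positive:
  assumes A: "A \<in> carrier_mat n n" and irr: "irreducible_mat A"
    and nonneg: "\<forall>i<n. \<forall>j<n. A $$ (i, j) \<ge> 0"
    and x: "\<And>i. i < n \<Longrightarrow> x i \<ge> 0" "\<exists>i<n. x i \<noteq> 0"
    and ev: "\<And>i. i < n \<Longrightarrow> apply_mat A x i = l * x i"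
    and i: "i < n"
  shows "x i > 0"
proof (rule ccontr)
  assume "\<not> x i > 0"
  with x(1)[OF i] have xi: "x i = 0" by simp
  define Z where "Z = {i. i < n \<and> x i = 0}"
  have "reducible_mat A"
  proof (rule reducible_mat_if_zero_block[OF A])
    show "Z \<subseteq> {..<n}" "Z \<noteq> {}" "Z \<noteq> {..<n}" using xi i x(2) unfolding Z_def by auto
    fix r j assume r: "r \<in> Z" and j: "j \<in> {..<n} - Z"
    have "(\<Sum>j<n. A $$ (r, j) * x j) = 0"
      using ev[of r] r A unfolding apply_mat_def Z_def by simp
    moreover have "\<And>j. j \<in> {..<n} \<Longrightarrow> 0 \<le> A $$ (r, j) * x j"
      using nonneg x(1) r unfolding Z_def by auto
    ultimately have "A $$ (r, j) * x j = 0"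
      using j sum_nonneg_eq_0_iff[of "{..<n}" "\<lambda>j. A $$ (r, j) * x j"] by auto
    then show "A $$ (r, j) = 0" using j unfolding Z_def by auto
  qed
  with irr show False unfolding irreducible_mat_def by simp
qed

section \<open>Regular blocks\<close>

lemma regular_submatrix_iff:
  assumes A: "A \<in> carrier_mat n n" and I: "I \<subseteq> {..<n}" and J: "J \<subseteq> {..<n}"
  shows "regular_mat (submatrix A I J) \<longleftrightarrow>
     (\<forall>i\<in>I. \<forall>i'\<in>I. (\<Sum>j\<in>J. A $$ (i, j)) = (\<Sum>j\<in>J. A $$ (i', j))) \<and>
     (\<forall>j\<in>J. \<forall>j'\<in>J. (\<Sum>i\<in>I. A $$ (i, j)) = (\<Sum>i\<in>I. A $$ (i, j')))"
proof -
  have bij: "bij_betw (pick S) {..<card S} S" if "finite S" for S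
  proof -
    have inj: "inj_on (pick S) {..<card S}"
      by (rule inj_onI) (metis card_pick lessThan_iff)
    have "pick S ` {..<card S} \<subseteq> S" using pick_in_set by auto
    with inj that have "pick S ` {..<card S} = S"
      by (intro card_subset_eq) (auto simp: card_image)
    with inj show ?thesis by (simp add: bij_betw_def)
  qed
  have eqs: "{i. i < dim_row A \<and> i \<in> I} = I" "{j. j < dim_col A \<and> j \<in> J} = J"
    using A I J by auto
  have bI: "bij_betw (pick I) {..<card I} I" and bJ: "bij_betw (pick J) {..<card J} J"
    using bij I J finite_subset by blast+
  have row: "(\<Sum>j<card J. submatrix A I J $$ (i, j)) = (\<Sum>j\<in>J. A $$ (pick I i, j))"
    if "i < card I" for i
    unfolding sum.reindex_bij_betw[OF bJ, symmetric]
    by (intro sum.cong refl) (use that in \<open>simp add: submatrix_def eqs\<close>)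
  have col: "(\<Sum>i<card I. submatrix A I J $$ (i, j)) = (\<Sum>i\<in>I. A $$ (i, pick J j))"
    if "j < card J" for j
    unfolding sum.reindex_bij_betw[OF bI, symmetric]
    by (intro sum.cong refl) (use that in \<open>simp add: submatrix_def eqs\<close>)
  have img: "pick I ` {..<card I} = I" "pick J ` {..<card J} = J"
    using bI bJ by (simp_all add: bij_betw_def)
  have ballI: "(\<forall>i\<in>I. R i) \<longleftrightarrow> (\<forall>i<card I. R (pick I i))" for R
    using ball_simps(9)[of "pick I" "{..<card I}" R] unfolding img by auto
  have ballJ: "(\<forall>j\<in>J. R j) \<longleftrightarrow> (\<forall>j<card J. R (pick J j))" for R
    using ball_simps(9)[of "pick J" "{..<card J}" R] unfolding img by auto
  show ?thesis
    unfolding regular_mat_def dim_submatrix eqs ballI ballJ using row col by simp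
qed

lemma regular_block_transpose:
  assumes A: "A \<in> carrier_mat n n" and I: "I \<subseteq> {..<n}" and J: "J \<subseteq> {..<n}"
    and sym: "\<forall>i<n. \<forall>j<n. A $$ (i, j) = A $$ (j, i)"
    and reg: "regular_mat (submatrix A I J)"
  shows "regular_mat (submatrix A J I)"
proof -
  have swap: "(\<Sum>j\<in>T. A $$ (i, j)) = (\<Sum>j\<in>T. A $$ (j, i))"
    if "i < n" "T \<subseteq> {..<n}" for i T
    by (intro sum.cong refl) (use sym that in auto)
  show ?thesis
    using reg swap[OF _ I] swap[OF _ J] I J
    unfolding regular_submatrix_iff[OF A I J] regular_submatrix_iff[OF A J I]
    by (smt (verit, best) lessThan_iff subsetD)
qed

section \<open>Lifting vectors along a partition\<close>

definition cell_of :: "nat \<Rightarrow> (nat \<Rightarrow> nat set) \<Rightarrow> nat \<Rightarrow> nat" where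
  "cell_of k P i = (THE p. p < k \<and> i \<in> P p)"

text \<open>The map \<open>y \<mapsto> S y\<close>, where the columns of \<open>S\<close> are the normalised indicator vectors of the
  cells. It is an isometry, and the quotient matrix is \<open>S\<^sup>T A S\<close>.\<close>

definition lift_vec :: "nat \<Rightarrow> (nat \<Rightarrow> nat set) \<Rightarrow> (nat \<Rightarrow> real) \<Rightarrow> nat \<Rightarrow> real" where
  "lift_vec k P y i = y (cell_of k P i) / sqrt (card (P (cell_of k P i)))"

context
  fixes n k :: nat and P :: "nat \<Rightarrow> nat set"
  assumes part: "indexed_partition n k P"
begin

lemma cell_subset: "p < k \<Longrightarrow> P p \<subseteq> {..<n}"
  using part unfolding indexed_partition_def partition_on_def by auto

lemma cell_finite: "p < k \<Longrightarrow> finite (P p)"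
  using cell_subset finite_subset by blast

lemma cell_card_pos: "p < k \<Longrightarrow> card (P p) > 0"
  using part cell_finite unfolding indexed_partition_def partition_on_def
  by (auto simp: card_gt_0_iff)

lemma cells_disjoint: "p < k \<Longrightarrow> q < k \<Longrightarrow> p \<noteq> q \<Longrightarrow> P p \<inter> P q = {}"
  using part unfolding indexed_partition_def partition_on_def disjoint_def inj_on_def
  by (metis imageI lessThan_iff)

lemma cells_cover: "{..<n} = (\<Union>p<k. P p)"
  using part unfolding indexed_partition_def partition_on_def by auto

lemma sum_over_cells: "(\<Sum>i<n. f i) = (\<Sum>p<k. \<Sum>i\<in>P p. f i)"
  unfolding cells_cover
  by (rule sum.UNION_disjoint) (use cell_finite cells_disjoint in auto)

lemma lift_vec_on_cell:
  assumes "p < k" "i \<in> P p"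
  shows "lift_vec k P y i = y p / sqrt (card (P p))"
proof -
  have "cell_of k P i = p"
    unfolding cell_of_def by (rule the_equality) (use assms cells_disjoint in blast)+
  then show ?thesis by (simp add: lift_vec_def)
qed

lemma norm_lift_vec: "(\<Sum>i<n. (lift_vec k P y i)\<^sup>2) = (\<Sum>p<k. (y p)\<^sup>2)"
proof -
  have "(\<Sum>i\<in>P p. (lift_vec k P y i)\<^sup>2) = (y p)\<^sup>2" if p: "p < k" for p
  proof -
    have "(\<Sum>i\<in>P p. (lift_vec k P y i)\<^sup>2) = (\<Sum>i\<in>P p. (y p)\<^sup>2 / card (P p))"
      by (intro sum.cong refl) (simp add: lift_vec_on_cell[OF p] power_divide)
    then show ?thesis using cell_card_pos[OF p] by simp
  qed
  then show ?thesis unfolding sum_over_cells by simp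
qed

lemma quotient_mat_entry:
  assumes "p < k" "q < k"
  shows "quotient_mat A k P $$ (p, q)
    = (\<Sum>i\<in>P p. \<Sum>j\<in>P q. A $$ (i, j)) / (sqrt (card (P p)) * sqrt (card (P q)) :: real)"
  using assms by (simp add: quotient_mat_def real_sqrt_mult)

lemma quad_form_lift_vec:
  assumes A: "A \<in> carrier_mat n n"
  shows "quad_form A (lift_vec k P y) = quad_form (quotient_mat A k P) y"
proof -
  let ?x = "lift_vec k P y"
  have dimQ: "dim_row (quotient_mat A k P) = k" by (simp add: quotient_mat_def)
  have "quad_form A ?x = (\<Sum>i<n. \<Sum>j<n. ?x i * (A $$ (i, j) * ?x j))"
    using A by (simp add: quad_form_def apply_mat_def sum_distrib_left)
  also have "\<dots> = (\<Sum>p<k. \<Sum>i\<in>P p. \<Sum>q<k. \<Sum>j\<in>P q. ?x i * (A $$ (i, j) * ?x j))"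
    by (simp only: sum_over_cells)
  also have "\<dots> = (\<Sum>p<k. \<Sum>q<k. \<Sum>i\<in>P p. \<Sum>j\<in>P q. ?x i * (A $$ (i, j) * ?x j))"
    by (intro sum.cong refl sum.swap)
  also have "\<dots> = (\<Sum>p<k. \<Sum>q<k. y p * (quotient_mat A k P $$ (p, q) * y q))"
  proof (intro sum.cong refl)
    fix p q assume "p \<in> {..<k}" "q \<in> {..<k}"
    then have p: "p < k" and q: "q < k" by auto
    have "(\<Sum>i\<in>P p. \<Sum>j\<in>P q. ?x i * (A $$ (i, j) * ?x j))
        = (\<Sum>i\<in>P p. \<Sum>j\<in>P q. y p / sqrt (card (P p)) * (A $$ (i, j) * (y q / sqrt (card (P q)))))"
      by (intro sum.cong refl) (simp add: lift_vec_on_cell[OF p] lift_vec_on_cell[OF q])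
    then show "(\<Sum>i\<in>P p. \<Sum>j\<in>P q. ?x i * (A $$ (i, j) * ?x j))
        = y p * (quotient_mat A k P $$ (p, q) * y q)"
      unfolding quotient_mat_entry[OF p q]
      by (simp add: sum_distrib_left sum_distrib_right sum_divide_distrib mult_ac)
  qed
  also have "\<dots> = quad_form (quotient_mat A k P) y"
    by (simp add: quad_form_def apply_mat_def dimQ sum_distrib_left)
  finally show ?thesis .
qed

lemma quotient_mat_symmetric:
  assumes sym: "\<forall>i<n. \<forall>j<n. A $$ (i, j) = (A $$ (j, i) :: real)" and p: "p < k" and q: "q < k"
  shows "quotient_mat A k P $$ (p, q) = quotient_mat A k P $$ (q, p)"
proof -
  have "(\<Sum>i\<in>P p. \<Sum>j\<in>P q. A $$ (i, j)) = (\<Sum>i\<in>P p. \<Sum>j\<in>P q. A $$ (j, i))"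
    by (intro sum.cong refl) (use sym cell_subset[OF p] cell_subset[OF q] in auto)
  also have "\<dots> = (\<Sum>j\<in>P q. \<Sum>i\<in>P p. A $$ (j, i))" by (rule sum.swap)
  finally show ?thesis using p q by (simp add: quotient_mat_entry mult.commute)
qed

lemma quotient_mat_nonneg:
  assumes nonneg: "\<forall>i<n. \<forall>j<n. A $$ (i, j) \<ge> (0::real)" and p: "p < k" and q: "q < k"
  shows "quotient_mat A k P $$ (p, q) \<ge> 0"
  unfolding quotient_mat_entry[OF p q]
  by (intro divide_nonneg_nonneg sum_nonneg mult_nonneg_nonneg)
    (use nonneg cell_subset[OF p] cell_subset[OF q] in auto)

section \<open>Comparison with the quotient matrix\<close>

lemma mu1_quotient_mat_le:
  fixes A :: "real mat"
  assumes A: "A \<in> carrier_mat n n" and n: "n \<ge> 1" and k: "k \<ge> 1"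
    and sym: "\<forall>i<n. \<forall>j<n. A $$ (i, j) = A $$ (j, i)"
  shows "mu1 (quotient_mat A k P) \<le> mu1 A"
proof -
  have Q: "quotient_mat A k P \<in> carrier_mat k k" by (simp add: quotient_mat_def)
  obtain y where y: "(\<Sum>p<k. (y p)\<^sup>2) = 1" "quad_form (quotient_mat A k P) y = mu1 (quotient_mat A k P)"
    using mu1_attained[OF Q k] quotient_mat_symmetric[OF sym] by blast
  show ?thesis
    using quad_form_le_mu1[OF A n sym, of "lift_vec k P y"] y
    by (simp add: quad_form_lift_vec[OF A] norm_lift_vec)
qed

text \<open>The transpose of the lift intertwines \<open>A\<close> with its quotient:
  the normalised cell sums of an eigenvector of \<open>A\<close> satisfy the eigenvalue equation of the
  quotient, because every column of the block \<open>(p, q)\<close> carries the fraction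
  \<open>1 / |P q|\<close> of the block sum.\<close>

lemma cell_sums_eigenvector:
  assumes A: "A \<in> carrier_mat n n" and eq: "equitable A k P"
    and ev: "\<And>i. i < n \<Longrightarrow> apply_mat A x i = l * x i" and p: "p < k"
  defines "y \<equiv> \<lambda>p. (\<Sum>i\<in>P p. x i) / sqrt (card (P p))"
  shows "apply_mat (quotient_mat A k P) y p = l * y p"
proof -
  define s where "s p = sqrt (card (P p))" for p
  have s2: "s q * s q = card (P q)" for q unfolding s_def by simp
  have block: "quotient_mat A k P $$ (p, q) * y q = (\<Sum>j\<in>P q. \<Sum>i\<in>P p. A $$ (i, j) * x j) / s p"
    if q: "q < k" for q
  proof -
    let ?T = "\<Sum>i\<in>P p. \<Sum>j\<in>P q. A $$ (i, j)"
    have cpos: "real (card (P q)) > 0" using cell_card_pos[OF q] by simp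
    have col: "(\<Sum>i\<in>P p. A $$ (i, j)) = ?T / card (P q)" if j: "j \<in> P q" for j
    proof -
      have "?T = (\<Sum>j'\<in>P q. \<Sum>i\<in>P p. A $$ (i, j'))" by (rule sum.swap)
      also have "\<dots> = (\<Sum>j'\<in>P q. \<Sum>i\<in>P p. A $$ (i, j))"
        using eq j p q regular_submatrix_iff[OF A cell_subset[OF p] cell_subset[OF q]]
        unfolding equitable_def by (intro sum.cong[OF refl, of "P q"]) blast
      finally show ?thesis using cpos by simp
    qed
    have "(\<Sum>j\<in>P q. \<Sum>i\<in>P p. A $$ (i, j) * x j) = (\<Sum>j\<in>P q. ?T / card (P q) * x j)"
      unfolding sum_distrib_right[symmetric] by (intro sum.cong refl) (simp only: col)
    also have "\<dots> = ?T / card (P q) * (\<Sum>j\<in>P q. x j)"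
      by (simp add: sum_distrib_left)
    finally show ?thesis
      unfolding quotient_mat_entry[OF p q] y_def s2[symmetric] by (simp add: s_def)
  qed
  have "apply_mat (quotient_mat A k P) y p = (\<Sum>q<k. quotient_mat A k P $$ (p, q) * y q)"
    by (simp add: apply_mat_def quotient_mat_def)
  also have "\<dots> = (\<Sum>q<k. \<Sum>j\<in>P q. \<Sum>i\<in>P p. A $$ (i, j) * x j) / s p"
    by (simp add: block sum_divide_distrib)
  also have "(\<Sum>q<k. \<Sum>j\<in>P q. \<Sum>i\<in>P p. A $$ (i, j) * x j) = (\<Sum>j<n. \<Sum>i\<in>P p. A $$ (i, j) * x j)"
    by (simp only: sum_over_cells)
  also have "\<dots> = (\<Sum>i\<in>P p. apply_mat A x i)"
    unfolding apply_mat_def using A by (subst sum.swap) simp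
  also have "\<dots> = (\<Sum>i\<in>P p. l * x i)"
    by (intro sum.cong refl ev) (use cell_subset[OF p] in auto)
  finally show ?thesis by (simp add: y_def s_def sum_distrib_left)
qed

lemma mu1_le_mu1_quotient_mat_if_equitable:
  fixes A :: "real mat"
  assumes A: "A \<in> carrier_mat n n" and n: "n \<ge> 1"
    and sym: "\<forall>i<n. \<forall>j<n. A $$ (i, j) = A $$ (j, i)"
    and nonneg: "\<forall>i<n. \<forall>j<n. A $$ (i, j) \<ge> 0"
    and eq: "equitable A k P"
  shows "mu1 A \<le> mu1 (quotient_mat A k P)"
proof -
  obtain x where x0: "\<And>i. x i \<ge> 0" and x1: "(\<Sum>i<n. (x i)\<^sup>2) = 1" and xq: "quad_form A x = mu1 A"
    using nonneg_maximiser[OF A n sym nonneg] by blast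
  have ev: "apply_mat A x i = mu1 A * x i" if "i < n" for i
    by (rule maximiser_is_eigenvector[OF A n sym _ that]) (simp add: xq x1)
  define y where "y p = (\<Sum>i\<in>P p. x i) / sqrt (card (P p))" for p
  \<comment> \<open>Nonnegativity of \<open>x\<close> is what prevents its cell sums from all cancelling.\<close>
  have "\<exists>p<k. y p \<noteq> 0"
  proof (rule ccontr)
    assume "\<not> ?thesis"
    then have "(\<Sum>i\<in>P p. x i) = 0" if "p < k" for p
      using that cell_card_pos[OF that] unfolding y_def by auto
    then have "(\<Sum>i<n. x i) = 0" unfolding sum_over_cells by simp
    then have "\<forall>i<n. x i = 0" using x0 by (subst (asm) sum_nonneg_eq_0_iff) auto
    with x1 show False by simp
  qed
  moreover have "apply_mat (quotient_mat A k P) y p = mu1 A * y p" if "p < k" for p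
    using cell_sums_eigenvector[OF A eq ev that] unfolding y_def by simp
  moreover have Q: "quotient_mat A k P \<in> carrier_mat k k" by (simp add: quotient_mat_def)
  ultimately have "eigenvalue (quotient_mat A k P) (mu1 A)"
    unfolding eigenvalue_iff_apply_mat[OF Q] by blast
  then show ?thesis by (rule eigenvalue_le_mu1[OF Q])
qed

text \<open>If the two largest eigenvalues agree, the lift of a nonnegative Perron vector of the quotient
  maximises the quadratic form of \<open>A\<close>, so it is a positive eigenvector of \<open>A\<close> that is constant on
  each cell. In row \<open>i\<close> of the eigenvalue equation every off-diagonal block then contributes
  an amount depending only on the cell of \<open>i\<close>, hence so does the diagonal block.\<close>

lemma diagonal_blocks_regular_if_mu1_eq:
  fixes A :: "real mat"
  assumes A: "A \<in> carrier_mat n n" and n: "n \<ge> 1" and k: "k \<ge> 1"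
    and sym: "\<forall>i<n. \<forall>j<n. A $$ (i, j) = A $$ (j, i)"
    and nonneg: "\<forall>i<n. \<forall>j<n. A $$ (i, j) \<ge> 0"
    and irr: "irreducible_mat A"
    and off: "\<And>p q. p < k \<Longrightarrow> q < k \<Longrightarrow> p \<noteq> q \<Longrightarrow> regular_mat (submatrix A (P p) (P q))"
    and mu: "mu1 A = mu1 (quotient_mat A k P)" and p: "p < k"
  shows "regular_mat (submatrix A (P p) (P p))"
proof -
  have Q: "quotient_mat A k P \<in> carrier_mat k k" by (simp add: quotient_mat_def)
  obtain y where y0: "\<And>p. y p \<ge> 0" and y1: "(\<Sum>p<k. (y p)\<^sup>2) = 1"
    and yq: "quad_form (quotient_mat A k P) y = mu1 (quotient_mat A k P)"
    using nonneg_maximiser[OF Q k] quotient_mat_symmetric[OF sym] quotient_mat_nonneg[OF nonneg]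
    by metis
  define x where "x = lift_vec k P y"
  have x1: "(\<Sum>i<n. (x i)\<^sup>2) = 1" using y1 by (simp add: x_def norm_lift_vec)
  have xq: "quad_form A x = mu1 A" using yq mu by (simp add: x_def quad_form_lift_vec[OF A])
  have ev: "apply_mat A x i = mu1 A * x i" if "i < n" for i
    by (rule maximiser_is_eigenvector[OF A n sym _ that]) (simp add: xq x1)
  have x0: "\<exists>i<n. x i \<noteq> 0"
  proof (rule ccontr)
    assume "\<not> ?thesis"
    then have "(\<Sum>i<n. (x i)\<^sup>2) = 0" by simp
    with x1 show False by simp
  qed
  have xnn: "x i \<ge> 0" for i unfolding x_def lift_vec_def using y0 by simp
  have xpos: "x i > 0" if "i < n" for i
    by (rule nonneg_eigenvector_positive[OF A irr nonneg xnn x0 ev that])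
  define z where "z p = y p / sqrt (card (P p))" for p
  have xz: "x i = z q" if "q < k" "i \<in> P q" for i q
    using lift_vec_on_cell[OF that] unfolding x_def z_def by simp
  have row: "z p * (\<Sum>j\<in>P p. A $$ (i, j))
      = mu1 A * z p - (\<Sum>q\<in>{..<k} - {p}. z q * (\<Sum>j\<in>P q. A $$ (i, j)))" if i: "i \<in> P p" for i
  proof -
    have "i < n" using i cell_subset[OF p] by auto
    have "mu1 A * z p = apply_mat A x i" using ev[OF \<open>i < n\<close>] xz[OF p i] by simp
    also have "\<dots> = (\<Sum>q<k. \<Sum>j\<in>P q. A $$ (i, j) * x j)"
      using A by (simp add: apply_mat_def sum_over_cells)
    also have "\<dots> = (\<Sum>q<k. z q * (\<Sum>j\<in>P q. A $$ (i, j)))"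
      unfolding sum_distrib_left by (intro sum.cong refl) (simp add: xz)
    also have "\<dots> = z p * (\<Sum>j\<in>P p. A $$ (i, j))
        + (\<Sum>q\<in>{..<k} - {p}. z q * (\<Sum>j\<in>P q. A $$ (i, j)))"
      using p by (intro sum.remove) auto
    finally show ?thesis by simp
  qed
  have rows: "(\<Sum>j\<in>P p. A $$ (i, j)) = (\<Sum>j\<in>P p. A $$ (i', j))"
    if i: "i \<in> P p" and i': "i' \<in> P p" for i i'
  proof -
    have "(\<Sum>q\<in>{..<k} - {p}. z q * (\<Sum>j\<in>P q. A $$ (i, j)))
        = (\<Sum>q\<in>{..<k} - {p}. z q * (\<Sum>j\<in>P q. A $$ (i', j)))"
    proof (intro sum.cong refl)
      fix q assume "q \<in> {..<k} - {p}"
      then have q: "q < k" "p \<noteq> q" by auto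
      have "(\<Sum>j\<in>P q. A $$ (i, j)) = (\<Sum>j\<in>P q. A $$ (i', j))"
        using off[OF p q] i i'
        unfolding regular_submatrix_iff[OF A cell_subset[OF p] cell_subset[OF q(1)]] by blast
      then show "z q * (\<Sum>j\<in>P q. A $$ (i, j)) = z q * (\<Sum>j\<in>P q. A $$ (i', j))" by simp
    qed
    with row[OF i] row[OF i'] have "z p * (\<Sum>j\<in>P p. A $$ (i, j)) = z p * (\<Sum>j\<in>P p. A $$ (i', j))"
      by simp
    moreover have "z p > 0" using xpos[of i] xz[OF p i] i cell_subset[OF p] by auto
    ultimately show ?thesis by simp
  qed
  have cols: "(\<Sum>i\<in>P p. A $$ (i, j)) = (\<Sum>i\<in>P p. A $$ (j, i))" if "j \<in> P p" for j
    by (intro sum.cong refl) (use that sym cell_subset[OF p] in auto)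
  show ?thesis
    unfolding regular_submatrix_iff[OF A cell_subset[OF p] cell_subset[OF p]]
  proof (intro conjI ballI)
    fix j j' assume j: "j \<in> P p" "j' \<in> P p"
    show "(\<Sum>i\<in>P p. A $$ (i, j)) = (\<Sum>i\<in>P p. A $$ (i, j'))"
      unfolding cols[OF j(1)] cols[OF j(2)] by (rule rows[OF j])
  qed (rule rows)
qed

end

theorem theorem9:
  fixes A :: "real mat" and n k :: nat and P :: "nat \<Rightarrow> nat set"
  assumes "n \<ge> 1"
    and "A \<in> carrier_mat n n"
    and "transpose_mat A = A"
    and "irreducible_mat A"
    and "\<forall>i<n. \<forall>j<n. A $$ (i, j) \<ge> 0"
    and "indexed_partition n k P"
    and "\<forall>i j. i < j \<and> j < k \<longrightarrow> regular_mat (submatrix A (P i) (P j))"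
  shows "(mu1 A = mu1 (quotient_mat A k P) \<longleftrightarrow> (\<forall>i<k. regular_mat (submatrix A (P i) (P i))))
       \<and> ((\<forall>i<k. regular_mat (submatrix A (P i) (P i))) \<longleftrightarrow> equitable A k P)"
proof -
  note n = assms(1) and A = assms(2) and irr = assms(4) and nonneg = assms(5) and part = assms(6)
  have sym: "\<forall>i<n. \<forall>j<n. A $$ (i, j) = A $$ (j, i)"
    using A assms(3) by (metis carrier_matD index_transpose_mat(1))
  have k: "k \<ge> 1"
    using cells_cover[OF part] n by (cases k) (auto simp: lessThan_empty_iff)
  have off: "regular_mat (submatrix A (P p) (P q))" if "p < k" "q < k" "p \<noteq> q" for p q
  proof (cases "p < q")
    case True
    then show ?thesis using assms(7) that by blast
  next
    case False
    then have "regular_mat (submatrix A (P q) (P p))" using assms(7) that by auto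
    then show ?thesis
      using regular_block_transpose[OF A _ _ sym] cell_subset[OF part] that by blast
  qed
  have eq: "(\<forall>i<k. regular_mat (submatrix A (P i) (P i))) \<longleftrightarrow> equitable A k P"
    unfolding equitable_def using off by metis
  moreover have "mu1 A = mu1 (quotient_mat A k P)" if "equitable A k P"
    using mu1_quotient_mat_le[OF part A n k sym]
      mu1_le_mu1_quotient_mat_if_equitable[OF part A n sym nonneg that] by simp
  moreover have "regular_mat (submatrix A (P p) (P p))"
    if "mu1 A = mu1 (quotient_mat A k P)" "p < k" for p
    using diagonal_blocks_regular_if_mu1_eq[OF part A n k sym nonneg irr off that] .
  ultimately show ?thesis by blast
qed

end
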